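(* Let $X$ be a complex Banach space and let $S:D(S)\subset X\to X$ and $T:D(T)\subset X\to X$ be two closed invertible linear operators whose inverses $S^{-1}$ and $T^{-1}$ are totally paranormal and quasisimilar. Then $\sigma(S)=\sigma(T)$ and $\sigma_{bd}(S)=\sigma_{bd}(T)$.
   Context: A closed operator $T:D(T)\subset X\to X$ is invertible if it is a bijection of $D(T)$ onto $X$ with bounded inverse $T^{-1}$ on $X$. A bounded operator $U$ on a Banach space $X$ is paranormal if $\|Ux\|^2\le\|U^2x\|\,\|x\|$ for all $x\in X$, and totally paranormal if $U-\lambda I$ is paranormal for all $\lambda\in\mathbb C$. A bounded operator between Banach spaces is quasi-invertible if it is injective with dense range; bounded operators $V\in L(X)$ and $U\in L(Y)$ are quasisimilar if there are quasi-invertible bounded operators $A:X\to Y$ and $B:Y\to X$ with $AV=UA$ and $BU=VB$. For a closed operator $T$, write $N(T)$, $R(T)$ for its nullspace and range and $\sigma(T)$ for its spectrum. Ascent: $a(T)=\inf\{n\in\mathbb N: N(T^n)=N(T^{n+1})\}$; descent: $\delta(T)=\inf\{n\in\mathbb N: R(T^n)=R(T^{n+1})\}$ (with $\inf\emptyset=\infty$, $\mathbb N=\{0,1,2,\dots\}$, and $T^n$ defined on its natural domain). $T$ is Drazin invertible if $a(T)$ and $\delta(T)$ are both finite. The Drazin spectrum is $\sigma_{D}(T)=\{\lambda\in\mathbb C: T-\lambda I\text{ is not Drazin invertible}\}$, and the B-discrete spectrum is $\sigma_{bd}(T)=\sigma(T)\setminus\sigma_D(T)$. *)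

theory Defs
  imports "HOL-Analysis.Analysis" "HOL-Library.Extended_Nat"
begin

text \<open>The norm and the topology are inherited from the underlying
  real space, whose scalar multiplication is the restriction of the complex one.\<close>

class complex_normed_vector = real_normed_vector +
  fixes scaleC :: "complex \<Rightarrow> 'a \<Rightarrow> 'a"  (infixr "*\<^sub>C" 75)
  assumes scaleC_add_right: "c *\<^sub>C (x + y) = c *\<^sub>C x + c *\<^sub>C y"
    and scaleC_add_left: "(c + d) *\<^sub>C x = c *\<^sub>C x + d *\<^sub>C x"
    and scaleC_scaleC: "c *\<^sub>C d *\<^sub>C x = (c * d) *\<^sub>C x"
    and scaleC_of_real: "complex_of_real r *\<^sub>C x = r *\<^sub>R x"
    and norm_scaleC: "norm (c *\<^sub>C x) = cmod c * norm x"

class complex_banach = complex_normed_vector + banach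

global_interpretation complex_vector:
  vector_space "scaleC :: complex \<Rightarrow> 'a \<Rightarrow> 'a::complex_normed_vector"
proof
  show "1 *\<^sub>C x = x" for x :: 'a
    using scaleC_of_real[of 1 x] by simp
qed (simp_all add: scaleC_add_right scaleC_add_left scaleC_scaleC)

instantiation complex :: complex_banach
begin

definition scaleC_complex :: "complex \<Rightarrow> complex \<Rightarrow> complex"
  where "scaleC_complex c x = c * x"

instance
  by standard (simp_all add: scaleC_complex_def algebra_simps norm_mult scaleR_conv_of_real)

end

definition bounded_clinear ::
    "('a::complex_normed_vector \<Rightarrow> 'b::complex_normed_vector) \<Rightarrow> bool"
  where "bounded_clinear A \<longleftrightarrow> bounded_linear A \<and> (\<forall>c x. A (c *\<^sub>C x) = c *\<^sub>C A x)"

definition paranormal :: "('a::complex_banach \<Rightarrow> 'a) \<Rightarrow> bool"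
  where "paranormal U \<longleftrightarrow>
    bounded_clinear U \<and> (\<forall>x. (norm (U x))\<^sup>2 \<le> norm (U (U x)) * norm x)"

definition totally_paranormal :: "('a::complex_banach \<Rightarrow> 'a) \<Rightarrow> bool"
  where "totally_paranormal U \<longleftrightarrow>
    bounded_clinear U \<and> (\<forall>\<mu>. paranormal (\<lambda>x. U x - \<mu> *\<^sub>C x))"

definition quasi_invertible :: "('a::complex_banach \<Rightarrow> 'b::complex_banach) \<Rightarrow> bool"
  where "quasi_invertible A \<longleftrightarrow> bounded_clinear A \<and> inj A \<and> closure (range A) = UNIV"

definition quasisimilar ::
    "('a::complex_banach \<Rightarrow> 'a) \<Rightarrow> ('b::complex_banach \<Rightarrow> 'b) \<Rightarrow> bool"
  where "quasisimilar V U \<longleftrightarrow>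
    bounded_clinear V \<and> bounded_clinear U \<and>
    (\<exists>A B. quasi_invertible A \<and> quasi_invertible B \<and> A \<circ> V = U \<circ> A \<and> B \<circ> U = V \<circ> B)"

text \<open>An operator T with domain D is given by the set D and a total function T of which only
  the values on D are relevant; all notions below depend on T only through its restriction to D.\<close>

definition closed_operator :: "'a::complex_banach set \<Rightarrow> ('a \<Rightarrow> 'a) \<Rightarrow> bool"
  where "closed_operator D T \<longleftrightarrow>
    complex_vector.subspace D \<and>
    (\<forall>x\<in>D. \<forall>y\<in>D. T (x + y) = T x + T y) \<and>
    (\<forall>c. \<forall>x\<in>D. T (c *\<^sub>C x) = c *\<^sub>C T x) \<and>
    closed {(x, T x) | x. x \<in> D}"

definition invertible_operator :: "'a::complex_banach set \<Rightarrow> ('a \<Rightarrow> 'a) \<Rightarrow> bool"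
  where "invertible_operator D T \<longleftrightarrow>
    bij_betw T D UNIV \<and> bounded_clinear (inv_into D T)"

text \<open>\<open>T - \<mu> I\<close> has the same domain as \<open>T\<close>.\<close>

definition shift_operator :: "('a::complex_banach \<Rightarrow> 'a) \<Rightarrow> complex \<Rightarrow> ('a \<Rightarrow> 'a)"
  where "shift_operator T \<mu> = (\<lambda>x. T x - \<mu> *\<^sub>C x)"

definition op_spectrum :: "'a::complex_banach set \<Rightarrow> ('a \<Rightarrow> 'a) \<Rightarrow> complex set"
  where "op_spectrum D T = {\<mu>. \<not> invertible_operator D (shift_operator T \<mu>)}"

text \<open>The natural domain of \<open>T\<^sup>n\<close>; for \<open>n = 0\<close> it is the whole space.\<close>

definition pow_domain :: "'a set \<Rightarrow> ('a \<Rightarrow> 'a) \<Rightarrow> nat \<Rightarrow> 'a set"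
  where "pow_domain D T n = {x. \<forall>k<n. (T ^^ k) x \<in> D}"

definition pow_nullspace :: "'a::complex_banach set \<Rightarrow> ('a \<Rightarrow> 'a) \<Rightarrow> nat \<Rightarrow> 'a set"
  where "pow_nullspace D T n = {x \<in> pow_domain D T n. (T ^^ n) x = 0}"

definition pow_range :: "'a set \<Rightarrow> ('a \<Rightarrow> 'a) \<Rightarrow> nat \<Rightarrow> 'a set"
  where "pow_range D T n = (T ^^ n) ` pow_domain D T n"

text \<open>In \<^typ>\<open>enat\<close> the infimum of the empty set is \<open>\<infinity>\<close>.\<close>

definition ascent :: "'a::complex_banach set \<Rightarrow> ('a \<Rightarrow> 'a) \<Rightarrow> enat"
  where "ascent D T = Inf {enat n | n. pow_nullspace D T n = pow_nullspace D T (n + 1)}"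

definition descent :: "'a::complex_banach set \<Rightarrow> ('a \<Rightarrow> 'a) \<Rightarrow> enat"
  where "descent D T = Inf {enat n | n. pow_range D T n = pow_range D T (n + 1)}"

definition drazin_invertible :: "'a::complex_banach set \<Rightarrow> ('a \<Rightarrow> 'a) \<Rightarrow> bool"
  where "drazin_invertible D T \<longleftrightarrow> ascent D T \<noteq> \<infinity> \<and> descent D T \<noteq> \<infinity>"

definition drazin_spectrum :: "'a::complex_banach set \<Rightarrow> ('a \<Rightarrow> 'a) \<Rightarrow> complex set"
  where "drazin_spectrum D T = {\<mu>. \<not> drazin_invertible D (shift_operator T \<mu>)}"

definition b_discrete_spectrum :: "'a::complex_banach set \<Rightarrow> ('a \<Rightarrow> 'a) \<Rightarrow> complex set"
  where "b_discrete_spectrum D T = op_spectrum D T - drazin_spectrum D T"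

end

theory Submission
  imports Defs
begin

text \<open>For \<open>\<nu> \<noteq> 0\<close> the operator \<open>S - \<nu> I\<close> has the same ranges of powers as \<open>W = S\<^sup>-\<^sup>1 - \<nu>\<^sup>-\<^sup>1 I\<close>,
  and since \<open>W\<close> is paranormal, \<open>W W x = 0\<close> forces \<open>W x = 0\<close>. Hence \<open>\<nu>\<close> lies outside the spectrum iff
  \<open>W\<close> is onto, and outside the Drazin spectrum iff \<open>W\<close> and \<open>W\<^sup>2\<close> have the same range.
  Both properties pass from a paranormal \<open>U\<close> to a paranormal \<open>V\<close> along an intertwiner \<open>B U = V B\<close> of
  dense range: by the open mapping theorem \<open>U\<close> is bounded below on \<open>R(U)\<close>, so each \<open>B z\<close> with
  \<open>z \<in> R(U)\<close> starts a backward \<open>V\<close>-orbit of controlled geometric growth, and paranormality of \<open>V\<close>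
  turns this into a lower bound for \<open>V\<close> on \<open>B (R(U))\<close>, hence on its closure, which is then \<open>R(V)\<close>.\<close>

section \<open>Open mapping for a bounded operator restricted to a closed subspace\<close>

text \<open>By Baire, the closure of the image of some ball of \<open>E\<close> contains a ball
  around a point \<open>y\<close>. Subtracting an approximate preimage of \<open>y\<close> from one
  of a nearby point handles small vectors, and scaling handles all others.\<close>

lemma approximate_preimage:
  fixes f :: "'a::real_normed_vector \<Rightarrow> 'b::banach"
  assumes "bounded_linear f" "subspace E" "f ` E = UNIV"
  shows "\<exists>K\<ge>0. \<forall>v. \<exists>e\<in>E. norm e \<le> K * norm v \<and> norm (v - f e) \<le> norm v / 2"
proof -
  interpret f: bounded_linear f by fact
  define A where "A n = closure (f ` (E \<inter> cball 0 (real n)))" for n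
  have "\<exists>n. interior (A n) \<noteq> {}"
  proof (rule ccontr)
    assume "\<not> ?thesis"
    then have "(euclidean :: 'b topology) interior_of \<Union>(range A) = {}"
      by (intro Baire_category_alt disjI1 completely_metrizable_space_euclidean)
        (auto simp: A_def)
    moreover have "v \<in> \<Union>(range A)" for v
    proof -
      obtain e where "e \<in> E" "f e = v" using assms(3) by (metis UNIV_I imageE)
      moreover obtain n where "norm e \<le> real n" using real_arch_simple by blast
      ultimately have "v \<in> A n"
        unfolding A_def by (intro subsetD[OF closure_subset]) auto
      then show ?thesis by blast
    qed
    then have "\<Union>(range A) = UNIV" by blast
    ultimately show False by simp
  qed
  then obtain n y r where r: "r > 0" "ball y r \<subseteq> A n"
    by (meson ex_in_conv mem_interior)
  show ?thesis
  proof (intro exI[of _ "4 * real n / r"] conjI allI)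
    show "0 \<le> 4 * real n / r" using r by simp
    fix v :: 'b
    show "\<exists>e\<in>E. norm e \<le> 4 * real n / r * norm v \<and> norm (v - f e) \<le> norm v / 2"
    proof (cases "v = 0")
      case True
      then show ?thesis by (intro bexI[of _ 0]) (auto simp: f.zero assms subspace_0)
    next
      case False
      \<comment> \<open>This scale gives \<open>w\<close> norm \<open>r / 2\<close>, so
        \<open>y + w\<close> stays in the ball; two errors of at most \<open>r / 8\<close> then add
        up to half the norm of \<open>w\<close>.\<close>
      define t where "t = 2 * norm v / r"
      have t: "t > 0" using False r by (simp add: t_def)
      define w where "w = (1 / t) *\<^sub>R v"
      have "norm w = r / 2" using False r by (simp add: w_def t_def)
      then have "y \<in> A n" and "y + w \<in> A n" using r by (auto simp: subset_iff dist_norm)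
      have approx: "\<exists>e\<in>E. norm e \<le> n \<and> norm (f e - z) < r / 8" if "z \<in> A n" for z
        using that r by (force simp: A_def closure_approachable dist_norm dest!: spec[of _ "r / 8"])
      obtain e1 where e1: "e1 \<in> E" "norm e1 \<le> n" "norm (f e1 - y) < r / 8"
        using approx[OF \<open>y \<in> A n\<close>] by blast
      obtain e2 where e2: "e2 \<in> E" "norm e2 \<le> n" "norm (f e2 - (y + w)) < r / 8"
        using approx[OF \<open>y + w \<in> A n\<close>] by blast
      note e = e1 e2
      have 1: "norm (e2 - e1) \<le> 2 * real n"
        using norm_triangle_ineq4[of e2 e1] e by linarith
      have "norm (w - f (e2 - e1)) = norm ((f e1 - y) - (f e2 - (y + w)))"
        by (simp add: f.diff algebra_simps)
      also have "\<dots> \<le> r / 4"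
        using norm_triangle_ineq4[of "f e1 - y" "f e2 - (y + w)"] e by linarith
      finally have 2: "norm (w - f (e2 - e1)) \<le> r / 4" .
      have "v - f (t *\<^sub>R (e2 - e1)) = t *\<^sub>R (w - f (e2 - e1))"
        using t by (simp add: w_def f.scaleR f.diff scaleR_right_diff_distrib)
      then have "norm (v - f (t *\<^sub>R (e2 - e1))) = t * norm (w - f (e2 - e1))"
        using t by simp
      also have "\<dots> \<le> t * (r / 4)" using 2 t by (intro mult_left_mono) auto
      also have "\<dots> = norm v / 2" using r by (simp add: t_def)
      finally have 3: "norm (v - f (t *\<^sub>R (e2 - e1))) \<le> norm v / 2" .
      have "norm (t *\<^sub>R (e2 - e1)) = t * norm (e2 - e1)" using t by simp
      also have "\<dots> \<le> t * (2 * real n)" using 1 t by (intro mult_left_mono) auto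
      also have "\<dots> = 4 * real n / r * norm v" by (simp add: t_def)
      finally show ?thesis using 3 e assms(2)
        by (intro bexI[of _ "t *\<^sub>R (e2 - e1)"]) (auto simp: subspace_diff subspace_scale)
    qed
  qed
qed

text \<open>Approximate preimages are summed while the residual halves at each step; the series
  stays in \<open>E\<close> because \<open>E\<close> is closed. A subspace as domain allows the
  application to \<open>N(U) \<times> X\<close> in \<open>paranormal_bounded_below\<close>.\<close>

lemma banach_open_mapping:
  fixes f :: "'a::banach \<Rightarrow> 'b::banach"
  assumes "bounded_linear f" "subspace E" "closed E" "f ` E = UNIV"
  shows "\<exists>C. \<forall>v. \<exists>e\<in>E. f e = v \<and> norm e \<le> C * norm v"
proof -
  interpret f: bounded_linear f by fact
  obtain K where "K \<ge> 0"
    and "\<forall>v. \<exists>e\<in>E. norm e \<le> K * norm v \<and> norm (v - f e) \<le> norm v / 2"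
    using approximate_preimage[OF assms(1,2,4)] by blast
  then obtain g where g: "\<And>v. g v \<in> E" "\<And>v. norm (g v) \<le> K * norm v"
      "\<And>v. norm (v - f (g v)) \<le> norm v / 2"
    by metis
  show ?thesis
  proof (intro exI[of _ "2 * K"] allI)
    fix v
    \<comment> \<open>\<open>u k\<close> is the residual after \<open>k\<close> corrections; the
      images of the corrections telescope to \<open>v\<close>.\<close>
    define u where "u k = ((\<lambda>v. v - f (g v)) ^^ k) v" for k
    have u_Suc: "u (Suc k) = u k - f (g (u k))" for k by (simp add: u_def)
    have nu: "norm (u k) \<le> norm v * (1/2) ^ k" for k
    proof (induction k)
      case (Suc k)
      then show ?case using g(3)[of "u k"] by (simp add: u_Suc)
    qed (simp add: u_def)
    have ng: "norm (g (u k)) \<le> K * norm v * (1/2) ^ k" for k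
      using mult_left_mono[OF nu[of k] \<open>K \<ge> 0\<close>] g(2)[of "u k"] by (simp add: mult.assoc)
    have sK: "(\<lambda>k. K * norm v * (1/2) ^ k) sums (2 * K * norm v)"
      using sums_mult[OF geometric_sums[of "1/2::real"], of "K * norm v"] by (simp add: mult_ac)
    then have "summable (\<lambda>k. K * norm v * (1/2) ^ k)" by (rule sums_summable)
    then have sn: "summable (\<lambda>k. norm (g (u k)))"
      by (rule summable_comparison_test[rotated]) (use ng in auto)
    then have s: "summable (\<lambda>k. g (u k))" by (rule summable_norm_cancel)
    have "u \<longlonglongrightarrow> 0"
    proof (rule Lim_null_comparison)
      show "(\<lambda>k. norm v * (1/2) ^ k) \<longlonglongrightarrow> 0" by (intro tendsto_mult_right_zero LIMSEQ_power_zero) simp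
    qed (use nu in auto)
    then have "(\<lambda>k. u k - u (Suc k)) sums (u 0 - 0)" by (rule telescope_sums')
    then have "(\<lambda>k. f (g (u k))) sums v" by (simp add: u_Suc) (simp add: u_def)
    then have "f (\<Sum>k. g (u k)) = v" using f.suminf[OF s] sums_unique by metis
    moreover have "norm (\<Sum>k. g (u k)) \<le> 2 * K * norm v"
      using summable_norm[OF sn] suminf_le[OF ng sn sums_summable[OF sK]] sums_unique[OF sK]
      by linarith
    moreover have "(\<Sum>k. g (u k)) \<in> E"
      by (rule closed_sequentially[OF assms(3) _ summable_LIMSEQ[OF s]])
        (use assms(2) g(1) in \<open>blast intro: subspace_sum\<close>)
    ultimately show "\<exists>e\<in>E. f e = v \<and> norm e \<le> 2 * K * norm v" by blast
  qed
qed

section \<open>Paranormal operators: kernels, backward orbits and lower bounds\<close>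

lemma paranormalD:
  assumes "paranormal U"
  shows "bounded_linear U" "(norm (U x))\<^sup>2 \<le> norm (U (U x)) * norm x"
  using assms by (auto simp: paranormal_def bounded_clinear_def)

lemma paranormal_kernel:
  assumes "paranormal U" "U (U x) = 0"
  shows "U x = 0"
  using paranormalD(2)[OF assms(1), of x] assms(2) by simp

lemma paranormal_funpow_kernel:
  assumes "paranormal U" "(U ^^ Suc n) x = 0"
  shows "U x = 0"
  using assms(2)
proof (induction n)
  case (Suc n)
  then show ?case using paranormal_kernel[OF assms(1), of "(U ^^ n) x"] by simp
qed simp

text \<open>Paranormality makes the ratios of consecutive norms along a backward orbit increase,
  so a growth rate of the orbit already bounds the first ratio.\<close>

lemma paranormal_backward_orbit:
  assumes "paranormal V" "\<And>n. V (x (Suc n)) = x n" "\<And>n. norm (x n) \<le> K * c ^ n" "c > 0"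
  shows "norm (x 1) \<le> c * norm (x 0)"
proof (cases "x 0 = 0")
  case True
  then have "V (V (x 2)) = 0" using assms(2)[of 0] assms(2)[of 1]
    using paranormalD(1)[OF assms(1)] by (simp add: numeral_2_eq_2)
  then have "V (x 2) = 0" by (rule paranormal_kernel[OF assms(1)])
  then show ?thesis using assms(2)[of 1] True by (simp add: numeral_2_eq_2)
next
  case False
  interpret V: bounded_linear V using paranormalD(1)[OF assms(1)] .
  have nz: "norm (x n) > 0" for n
  proof (induction n)
    case (Suc n)
    then show ?case using assms(2)[of n] V.zero by auto
  qed (use False in simp)
  define \<rho> where "\<rho> = norm (x 1) / norm (x 0)"
  have \<rho>: "\<rho> > 0" using nz[of 0] nz[of 1] by (simp add: \<rho>_def)
  have step: "norm (x (Suc n)) \<ge> \<rho> * norm (x n)" for n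
  proof (induction n)
    case 0
    show ?case using nz[of 0] by (simp add: \<rho>_def)
  next
    case (Suc n)
    have "\<rho> * norm (x (Suc n)) * norm (x n) = norm (x (Suc n)) * (\<rho> * norm (x n))"
      by simp
    also have "\<dots> \<le> (norm (x (Suc n)))\<^sup>2"
      unfolding power2_eq_square using Suc by (intro mult_left_mono) auto
    also have "\<dots> \<le> norm (x (Suc (Suc n))) * norm (x n)"
      using paranormalD(2)[OF assms(1), of "x (Suc (Suc n))"] assms(2) by (simp add: mult.commute)
    finally show ?case using nz[of n] by simp
  qed
  have low: "norm (x n) \<ge> norm (x 0) * \<rho> ^ n" for n
  proof (induction n)
    case (Suc n)
    have "norm (x 0) * \<rho> ^ Suc n \<le> \<rho> * norm (x n)"
      using mult_left_mono[OF Suc, of \<rho>] \<rho> by (simp add: mult_ac)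
    then show ?case using step[of n] by linarith
  qed simp
  \<comment> \<open>Otherwise the lower bound of rate \<open>\<rho>\<close> eventually overtakes the
    upper bound of rate \<open>c\<close>.\<close>
  have "\<rho> \<le> c"
  proof (rule ccontr)
    assume "\<not> \<rho> \<le> c"
    then have "\<rho> / c > 1" using assms(4) by simp
    then obtain n where "K / norm (x 0) < (\<rho> / c) ^ n" using real_arch_pow by blast
    then have "K * c ^ n < norm (x 0) * \<rho> ^ n"
      using nz[of 0] assms(4) by (simp add: power_divide field_simps)
    then show False using low[of n] assms(3)[of n] by linarith
  qed
  then show ?thesis using nz[of 0] by (simp add: \<rho>_def field_simps)
qed

text \<open>The hypothesis makes \<open>(n, y) \<mapsto> n + U (U y)\<close> map
  \<open>N(U) \<times> X\<close> onto \<open>X\<close>. The open mapping theorem solves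
  \<open>n + U (U y) = U z\<close> with control on \<open>y\<close>, and triviality of
  \<open>N(U)\<close> on \<open>R(U)\<close> forces \<open>z = U y\<close>.\<close>

lemma paranormal_bounded_below:
  assumes "paranormal U" "range U \<subseteq> range (U \<circ> U)"
  shows "\<exists>C. \<forall>z\<in>range U. norm z \<le> C * norm (U z)"
proof -
  interpret U: bounded_linear U using paranormalD(1)[OF assms(1)] .
  define f where "f p = fst p + U (U (snd p))" for p :: "'a \<times> 'a"
  define E where "E = {n. U n = 0} \<times> (UNIV :: 'a set)"
  have "bounded_linear f"
    unfolding f_def
    by (intro bounded_linear_add bounded_linear_fst
        bounded_linear_compose[OF U.bounded_linear_axioms] bounded_linear_snd)
  moreover have "subspace E"
    by (auto simp: E_def subspace_def U.zero U.add U.scaleR zero_prod_def)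
  moreover have "closed E"
    unfolding E_def
    by (intro closed_Times closed_UNIV closed_Collect_eq continuous_on_const
        linear_continuous_on U.bounded_linear_axioms)
  moreover have "y \<in> f ` E" for y
  proof -
    \<comment> \<open>Using the range inclusion twice gives \<open>U y = U (U (U w'))\<close>, so
      \<open>y\<close> differs from \<open>U (U w')\<close> by a kernel vector.\<close>
    obtain w where "U y = U (U w)" using assms(2) by (auto simp: image_iff subset_iff)
    moreover obtain w' where "U w = U (U w')" using assms(2) by (auto simp: image_iff subset_iff)
    ultimately have "(y - U (U w'), w') \<in> E" by (simp add: E_def U.diff)
    then show ?thesis by (rule rev_image_eqI) (simp add: f_def)
  qed
  then have "f ` E = UNIV" by blast
  ultimately obtain C where C: "\<And>v. \<exists>e\<in>E. f e = v \<and> norm e \<le> C * norm v"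
    using banach_open_mapping[of f E] by blast
  obtain L where L: "\<And>x. norm (U x) \<le> norm x * L" "L > 0" using U.pos_bounded by blast
  have "norm z \<le> (C * L) * norm (U z)" if z: "z \<in> range U" for z
  proof -
    obtain w where w: "z = U w" using z by blast
    obtain n y where ny: "U n = 0" "n + U (U y) = U z" "norm (n, y) \<le> C * norm (U z)"
      using C[of "U z"] by (auto simp: E_def f_def)
    \<comment> \<open>The kernel part \<open>n\<close> lies in the range of \<open>U\<close>, so
      \<open>w - y\<close> is killed by the third power of \<open>U\<close>, hence by
      \<open>U\<close> itself.\<close>
    have "n = U (U (w - y))" using ny(2) w by (simp add: U.diff algebra_simps)
    then have "U (U (U (w - y))) = 0" using ny(1) by simp
    then have "U (w - y) = 0" using paranormal_kernel[OF assms(1)] by blast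
    then have "z = U y" using w by (simp add: U.diff)
    then have "norm z \<le> norm y * L" using L by simp
    also have "\<dots> \<le> norm (n, y) * L"
      using L(2) norm_snd_le[of y n] by (intro mult_right_mono) auto
    also have "\<dots> \<le> C * norm (U z) * L" using ny(3) L(2) by (intro mult_right_mono) auto
    finally show ?thesis by (simp add: mult_ac)
  qed
  then show ?thesis by blast
qed

section \<open>Transfer of range conditions along a dense-range intertwiner\<close>

text \<open>Let \<open>M\<close> be the closure of the image of \<open>range U\<close> under
  \<open>B\<close>. Continuity and density give \<open>range V \<subseteq> M\<close>; the lower
  bound for \<open>V\<close> shows that \<open>V\<close> maps \<open>M\<close> onto a set containing
  \<open>M\<close>. Both conclusions follow.\<close>

lemma paranormal_range_transfer:
  fixes V :: "'a::complex_banach \<Rightarrow> 'a" and U :: "'b::complex_banach \<Rightarrow> 'b"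
  assumes V: "paranormal V" and U: "paranormal U" "range U \<subseteq> range (U \<circ> U)"
    and B: "bounded_linear B" "closure (range B) = UNIV" "\<And>y. B (U y) = V (B y)"
  shows "range V = closure (B ` range U)" "range V \<subseteq> range (V \<circ> V)"
proof -
  interpret U: bounded_linear U using paranormalD(1)[OF U(1)] .
  interpret V: bounded_linear V using paranormalD(1)[OF V] .
  interpret B: bounded_linear B by fact
  have contV: "continuous_on S V" for S by (rule linear_continuous_on[OF V.bounded_linear_axioms])
  obtain C where C: "\<And>z. z \<in> range U \<Longrightarrow> norm z \<le> C * norm (U z)"
    using paranormal_bounded_below[OF U] by blast
  \<comment> \<open>The maximum with 1 makes the growth rate positive, as the orbit lemma
    requires.\<close>
  define c where "c = max C 1"
  have c: "c > 0" by (simp add: c_def)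
  have cb: "norm z \<le> c * norm (U z)" if "z \<in> range U" for z
    using C[OF that] mult_right_mono[of C c "norm (U z)"] by (simp add: c_def)
  have "\<forall>z\<in>range U. \<exists>w\<in>range U. U w = z"
    using U(2) by fastforce
  then obtain s where s: "\<And>z. z \<in> range U \<Longrightarrow> s z \<in> range U \<and> U (s z) = z" by metis
  define M where "M = closure (B ` range U)"
  have bb0: "norm (B z) \<le> c * norm (V (B z))" if z: "z \<in> range U" for z
  proof -
    \<comment> \<open>The orbit starts at \<open>U z\<close> so that the first ratio of its
      \<open>B\<close>-image compares \<open>B z\<close> with \<open>V (B z)\<close>.\<close>
    define y where "y n = (s ^^ n) (U z)" for n
    have yr: "y n \<in> range U" for n
      by (induction n) (use s in \<open>auto simp: y_def\<close>)
    have Uy: "U (y (Suc n)) = y n" for n using s[OF yr[of n]] by (simp add: y_def)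
    have ny: "norm (y n) \<le> norm (U z) * c ^ n" for n
    proof (induction n)
      case (Suc n)
      have "norm (y (Suc n)) \<le> c * norm (y n)" using cb[OF yr[of "Suc n"]] Uy by simp
      also have "\<dots> \<le> c * (norm (U z) * c ^ n)" using Suc c by (intro mult_left_mono) auto
      finally show ?case by (simp add: mult_ac)
    qed (simp add: y_def)
    \<comment> \<open>Whichever preimage \<open>s\<close> selects, \<open>U\<close> is injective on
      its range, so \<open>y 1\<close> is \<open>z\<close>.\<close>
    obtain w where w: "z = U w" using z by blast
    obtain w' where w': "y 1 = U w'" using yr by blast
    have "U (U (w' - w)) = 0" using Uy[of 0] w w' by (simp add: U.diff y_def)
    then have "U (w' - w) = 0" by (rule paranormal_kernel[OF U(1)])
    then have y1: "y 1 = z" using w w' by (simp add: U.diff)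
    obtain K where K: "\<And>x. norm (B x) \<le> norm x * K" "K > 0" using B.pos_bounded by blast
    have "norm (B (y n)) \<le> (norm (U z) * K) * c ^ n" for n
      using order_trans[OF K(1)[of "y n"] mult_right_mono[OF ny[of n], of K]] K(2)
      by (simp add: mult_ac)
    then have "norm (B (y 1)) \<le> c * norm (B (y 0))"
      using paranormal_backward_orbit[OF V, of "\<lambda>n. B (y n)"] c Uy B(3) by metis
    then show ?thesis using y1 B(3) by (simp add: y_def)
  qed
  have rangeV: "range V \<subseteq> M"
  proof -
    have "V ` closure (range B) \<subseteq> M"
      using contV by (intro image_closure_subset)
        (auto simp: M_def B(3)[symmetric] intro: subsetD[OF closure_subset])
    then show ?thesis by (simp add: B(2))
  qed
  have M: "M \<subseteq> V ` M"
  proof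
    fix m assume "m \<in> M"
    then obtain x where x: "\<And>k. x k \<in> B ` range U" "x \<longlonglongrightarrow> m"
      unfolding M_def closure_sequential by blast
    have "\<exists>w\<in>range U. x k = V (B w)" for k
      using x(1)[of k] s B(3) by (metis imageE)
    then obtain w where w: "\<And>k. w k \<in> range U" "\<And>k. x k = V (B (w k))" by metis
    \<comment> \<open>\<open>range U\<close> is a subspace, so the lower bound also applies to
      differences; convergence of \<open>x\<close> thus makes the preimages Cauchy.\<close>
    have bnd: "norm (B (w k) - B (w l)) \<le> c * norm (x k - x l)" for k l
    proof -
      obtain a b where "w k = U a" "w l = U b" using w(1) by blast
      then have "w k - w l \<in> range U" by (metis U.diff rangeI)
      from bb0[OF this] show ?thesis by (simp add: w(2) B.diff V.diff)
    qed
    have "Cauchy (\<lambda>k. B (w k))"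
    proof (rule metric_CauchyI)
      fix e :: real assume "e > 0"
      then have "e / c > 0" using c by simp
      then obtain N where N: "\<And>k l. k \<ge> N \<Longrightarrow> l \<ge> N \<Longrightarrow> dist (x k) (x l) < e / c"
        using metric_CauchyD[OF LIMSEQ_imp_Cauchy[OF x(2)]] by blast
      show "\<exists>N. \<forall>k\<ge>N. \<forall>l\<ge>N. dist (B (w k)) (B (w l)) < e"
      proof (intro exI[of _ N] allI impI)
        fix k l assume "k \<ge> N" "l \<ge> N"
        from N[OF this] have "c * norm (x k - x l) < e"
          using c by (simp add: dist_norm field_simps)
        with bnd[of k l] show "dist (B (w k)) (B (w l)) < e" by (simp add: dist_norm)
      qed
    qed
    then obtain u where u: "(\<lambda>k. B (w k)) \<longlonglongrightarrow> u" using Cauchy_convergent convergentD by blast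
    then have "u \<in> M" unfolding M_def closure_sequential using w(1) by (intro exI[of _ "\<lambda>k. B (w k)"]) auto
    moreover have "x = (\<lambda>k. V (B (w k)))" using w(2) by blast
    then have "x \<longlonglongrightarrow> V u" using V.tendsto[OF u] by simp
    then have "V u = m" using x(2) LIMSEQ_unique by blast
    ultimately show "m \<in> V ` M" by blast
  qed
  then show r: "range V = closure (B ` range U)" using rangeV by (auto simp: M_def)
  then show "range V \<subseteq> range (V \<circ> V)"
    using M unfolding M_def image_comp[symmetric] by simp
qed

lemma paranormal_surj_transfer:
  assumes "paranormal V" "paranormal U" "surj U"
    and B: "bounded_linear B" "closure (range B) = UNIV" "\<And>y. B (U y) = V (B y)"
  shows "surj V"
proof -
  have "range U \<subseteq> range (U \<circ> U)" using comp_surj[OF assms(3,3)] by simp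
  from paranormal_range_transfer(1)[of V U B, OF assms(1,2) this B] show ?thesis
    using assms(3) B(2) by simp
qed

text \<open>By surjectivity a kernel vector is some \<open>U w\<close>, and then
  \<open>U (U w) = 0\<close> forces \<open>U w = 0\<close>.\<close>

lemma paranormal_surj_inj:
  assumes "paranormal U" "surj U" "U x = U y"
  shows "x = y"
proof -
  interpret U: bounded_linear U using paranormalD(1)[OF assms(1)] .
  obtain w where w: "x - y = U w" using assms(2) by (metis surjD)
  then have "U (U w) = 0" using assms(3) by (metis U.diff eq_iff_diff_eq_0)
  then have "U w = 0" by (rule paranormal_kernel[OF assms(1)])
  then show ?thesis using w by simp
qed

section \<open>From the unbounded operator to its shifted bounded inverse\<close>

context
  fixes D :: "'a::complex_banach set" and S V
  assumes closed: "closed_operator D S" and inv: "invertible_operator D S"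
    and V_def: "V = inv_into D S" and tp: "totally_paranormal V"
begin

private lemma V_linear: "bounded_linear V" "V (c *\<^sub>C x) = c *\<^sub>C V x"
  using tp by (auto simp: totally_paranormal_def bounded_clinear_def)

private lemma V_dom: "V y \<in> D" and S_V: "S (V y) = y"
  using inv by (auto simp: invertible_operator_def V_def bij_betw_def inv_into_into f_inv_into_f)

private lemma V_S: "x \<in> D \<Longrightarrow> V (S x) = x"
  using inv by (auto simp: invertible_operator_def V_def bij_betw_def inv_into_f_f)

private lemma shift_paranormal: "paranormal (\<lambda>x. V x - \<mu> *\<^sub>C x)"
  using tp by (simp add: totally_paranormal_def)

private lemma D_subspace: "complex_vector.subspace D"
  using closed by (simp add: closed_operator_def)

context
  fixes \<nu> \<mu> :: complex and W R
  assumes nz: "\<nu> \<noteq> 0" and mu: "\<mu> = 1 / \<nu>"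
    and W_def: "W = (\<lambda>x. V x - \<mu> *\<^sub>C x)" and R_def: "R = shift_operator S \<nu>"
begin

private lemma W: "paranormal W"
  unfolding W_def by (rule shift_paranormal)

private lemma W_linear: "bounded_linear W" "W (c *\<^sub>C x) = c *\<^sub>C W x"
  using W by (auto simp: paranormal_def bounded_clinear_def)

text \<open>This factorization, \<open>(S - \<nu>) V = - \<nu> W\<close>, carries every later
  comparison between \<open>R\<close> and \<open>W\<close>.\<close>

private lemma R_V: "R (V y) = (- \<nu>) *\<^sub>C W y"
proof -
  have "(- \<nu>) *\<^sub>C W y = y - \<nu> *\<^sub>C V y"
    using nz by (simp add: W_def mu complex_vector.scale_right_diff_distrib)
  then show ?thesis by (simp add: R_def shift_operator_def S_V)
qed

private lemma R_image_V: "R ` D = range W"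
proof -
  have "D = range V" using V_dom V_S by (metis image_subset_iff rangeI subsetI subset_antisym)
  then have "R ` D = range (\<lambda>y. (- \<nu>) *\<^sub>C W y)" by (auto simp: R_V image_iff)
  moreover have "(- \<nu>) *\<^sub>C W y \<in> range W" for y by (simp only: W_linear(2)[symmetric] rangeI)
  moreover have "W y \<in> range (\<lambda>y. (- \<nu>) *\<^sub>C W y)" for y
    using nz by (intro range_eqI[of _ _ "(- 1 / \<nu>) *\<^sub>C y"])
      (simp add: W_linear del: complex_vector.scale_minus_left)
  ultimately show ?thesis by (metis (no_types, lifting) image_subset_iff subset_antisym)
qed

text \<open>Since \<open>D\<close> is the range of \<open>V\<close>, the factorization gives
  \<open>R\<close> and \<open>W\<close> the same range. Surjectivity of \<open>W\<close> already
  yields injectivity and a lower bound, hence a bounded inverse \<open>G\<close>, and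
  \<open>R\<close> is inverted by \<open>V\<close> after \<open>G\<close> after multiplication by
  \<open>- \<mu>\<close>.\<close>

private lemma spectrum_iff: "\<nu> \<notin> op_spectrum D S \<longleftrightarrow> surj W"
proof
  assume "\<nu> \<notin> op_spectrum D S"
  then show "surj W"
    using R_image_V by (auto simp: op_spectrum_def invertible_operator_def R_def bij_betw_def)
next
  assume surj: "surj W"
  have injW: "W x = W y \<Longrightarrow> x = y" for x y by (rule paranormal_surj_inj[OF W surj])
  interpret W: bounded_linear W by (rule W_linear)
  interpret V: bounded_linear V by (rule V_linear)
  have inj: "inj_on R D"
  proof (rule inj_onI)
    fix x y assume xy: "x \<in> D" "y \<in> D" "R x = R y"
    then have "R (V (S x)) = R (V (S y))" by (simp add: V_S)
    then have "(- \<nu>) *\<^sub>C W (S x) = (- \<nu>) *\<^sub>C W (S y)" by (simp only: R_V)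
    then have "S x = S y" using nz injW by simp
    then show "x = y" using xy V_S by metis
  qed
  have bij: "bij_betw R D UNIV" using inj R_image_V surj by (simp add: bij_betw_def)
  have "range W \<subseteq> range (W \<circ> W)" using comp_surj[OF surj surj] by simp
  then obtain C where C: "\<And>z. norm z \<le> C * norm (W z)"
    using paranormal_bounded_below[OF W] surj by auto
  define G where "G = inv W"
  have WG: "W (G y) = y" for y using surj by (simp add: G_def surj_f_inv_f)
  have G_add: "G (x + y) = G x + G y" for x y by (rule injW) (simp add: WG W.add)
  have G_C: "G (c *\<^sub>C x) = c *\<^sub>C G x" for c x by (rule injW) (simp add: WG W_linear)
  have G_bounded: "bounded_linear G"
  proof (rule bounded_linear_intro[of _ C])
    show "G (r *\<^sub>R x) = r *\<^sub>R G x" for r x using G_C[of "complex_of_real r" x] by (simp add: scaleC_of_real)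
    show "norm (G x) \<le> norm x * C" for x using C[of "G x"] by (simp add: WG mult.commute)
  qed (rule G_add)
  have scal: "bounded_linear (\<lambda>x::'a. (- \<mu>) *\<^sub>C x)"
  proof (rule bounded_linear_intro[of _ "cmod \<mu>"])
    show "(- \<mu>) *\<^sub>C (r *\<^sub>R x) = r *\<^sub>R ((- \<mu>) *\<^sub>C x)" for r and x :: 'a
      by (simp add: scaleC_of_real[symmetric] complex_vector.scale_left_commute)
  qed (simp_all add: complex_vector.scale_right_distrib norm_scaleC mult.commute
      del: complex_vector.scale_minus_left)
  have bl: "bounded_linear (\<lambda>y. V (G ((- \<mu>) *\<^sub>C y)))"
    by (rule bounded_linear_compose[OF V_linear(1) bounded_linear_compose[OF G_bounded scal]])
  have "inv_into D R = (\<lambda>y. V (G ((- \<mu>) *\<^sub>C y)))"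
  proof
    fix y
    have "R (V (G ((- \<mu>) *\<^sub>C y))) = y"
      using nz by (simp add: R_V WG mu del: complex_vector.scale_minus_left)
    then show "inv_into D R y = V (G ((- \<mu>) *\<^sub>C y))"
      using inj V_dom inv_into_f_f by metis
  qed
  moreover have "bounded_clinear (\<lambda>y. V (G ((- \<mu>) *\<^sub>C y)))"
    using bl unfolding bounded_clinear_def
    by (simp add: G_C V_linear(2) complex_vector.scale_left_commute[of "- \<mu>"]
        del: complex_vector.scale_minus_left)
  ultimately show "\<nu> \<notin> op_spectrum D S"
    using bij by (simp add: op_spectrum_def invertible_operator_def R_def)
qed

private lemma funpow_W_scale: "(W ^^ n) (c *\<^sub>C x) = c *\<^sub>C (W ^^ n) x"
  by (induction n) (simp_all add: W_linear)

private lemma funpow_W_diff: "(W ^^ n) (x - y) = (W ^^ n) x - (W ^^ n) y"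
  by (induction n) (simp_all add: bounded_linear.linear[OF W_linear(1)] linear_diff)

private lemma V_W: "V (W y) = W (V y)"
  by (simp add: W_def V_linear linear_diff[OF bounded_linear.linear[OF V_linear(1)]])

private lemma V_funpow_W: "V ((W ^^ n) y) = (W ^^ n) (V y)"
  by (induction n) (simp_all add: V_W)

text \<open>Because \<open>z = \<nu> (V z - W z)\<close> and \<open>V z\<close> always lies in the
  subspace \<open>D\<close>.\<close>

private lemma W_dom: "W z \<in> D \<Longrightarrow> z \<in> D"
proof -
  assume "W z \<in> D"
  then have "V z - W z \<in> D" using V_dom D_subspace by (intro complex_vector.subspace_diff) auto
  then have "\<nu> *\<^sub>C \<mu> *\<^sub>C z \<in> D"
    by (intro complex_vector.subspace_scale[OF D_subspace, of "\<mu> *\<^sub>C z"]) (simp add: W_def)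
  then show "z \<in> D" using nz by (simp add: mu)
qed

private lemma funpow_W_dom: "(W ^^ n) z \<in> D \<Longrightarrow> z \<in> D"
  by (induction n) (auto dest: W_dom)

text \<open>Induction on \<open>n\<close>: a vector of \<open>D\<close> of the form
  \<open>(W ^^ n) z\<close> has \<open>z \<in> D\<close>, so \<open>z = V (S z)\<close>. As
  \<open>V\<close> commutes with \<open>W\<close>, the vector is \<open>V\<close> applied to
  \<open>(W ^^ n) (S z)\<close>, and the factorization turns \<open>R\<close> into one more
  \<open>W\<close>.\<close>

private lemma pow_range_shift: "pow_range D R n = range (W ^^ n)"
proof (induction n)
  case 0
  then show ?case by (simp add: pow_range_def pow_domain_def)
next
  case (Suc n)
  have "pow_domain D R (Suc n) = {x \<in> pow_domain D R n. (R ^^ n) x \<in> D}"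
    by (auto simp: pow_domain_def less_Suc_eq)
  then have "pow_range D R (Suc n) = R ` (D \<inter> pow_range D R n)"
    by (auto simp: pow_range_def image_iff)
  also have "\<dots> = R ` (D \<inter> range (W ^^ n))" by (simp add: Suc)
  also have "\<dots> = range (W ^^ Suc n)"
  proof (intro equalityI subsetI)
    fix y assume "y \<in> R ` (D \<inter> range (W ^^ n))"
    then obtain z where z: "(W ^^ n) z \<in> D" "y = R ((W ^^ n) z)" by blast
    then have "z = V (S z)" using funpow_W_dom V_S by metis
    then have "y = R (V ((W ^^ n) (S z)))" using z(2) V_funpow_W by metis
    also have "\<dots> = (W ^^ Suc n) ((- \<nu>) *\<^sub>C S z)" by (simp add: R_V W_linear funpow_W_scale del: complex_vector.scale_minus_left)
    finally show "y \<in> range (W ^^ Suc n)" by blast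
  next
    fix y assume "y \<in> range (W ^^ Suc n)"
    then obtain z where z: "y = (W ^^ Suc n) z" by blast
    have "R (V ((W ^^ n) ((- \<mu>) *\<^sub>C z))) = y"
      using nz by (simp add: z R_V W_linear funpow_W_scale mu del: complex_vector.scale_minus_left)
    then show "y \<in> R ` (D \<inter> range (W ^^ n))"
      using V_dom V_funpow_W by (metis IntI image_eqI rangeI)
  qed
  finally show ?case .
qed

text \<open>The ascent is at most 1, because \<open>W (W y) = 0\<close> implies
  \<open>W y = 0\<close>. Finiteness of the descent is therefore the only condition left for Drazin
  invertibility.\<close>

private lemma ascent_shift: "ascent D R \<noteq> \<infinity>"
proof -
  have "pow_nullspace D R 2 \<subseteq> pow_nullspace D R 1"
  proof
    fix x assume "x \<in> pow_nullspace D R 2"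
    then have x: "x \<in> D" "R x \<in> D" "R (R x) = 0"
      by (auto simp: pow_nullspace_def pow_domain_def numeral_2_eq_2 less_Suc_eq)
    have "(- \<nu>) *\<^sub>C W (S (R x)) = 0" using x R_V[of "S (R x)"] by (simp add: V_S)
    then have "W (S (R x)) = 0" using nz by simp
    \<comment> \<open>Applying \<open>V\<close> and commuting it past \<open>W\<close> removes
      \<open>S\<close>, leaving \<open>W (R x) = 0\<close>.\<close>
    then have "W (V (S (R x))) = 0"
      by (metis V_W V_linear(1) bounded_linear.linear linear_0)
    then have "W (R x) = 0" using x V_S by simp
    moreover have "R x = (- \<nu>) *\<^sub>C W (S x)" using x R_V[of "S x"] by (simp add: V_S)
    ultimately have "W (W (S x)) = 0"
      using nz by (simp add: W_linear del: complex_vector.scale_minus_left)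
    then have "W (S x) = 0" by (rule paranormal_kernel[OF W])
    then have "R x = 0" using \<open>R x = (- \<nu>) *\<^sub>C W (S x)\<close> by simp
    then show "x \<in> pow_nullspace D R 1"
      using x by (simp add: pow_nullspace_def pow_domain_def)
  qed
  \<comment> \<open>The natural domain of the square also demands \<open>R x \<in> D\<close>, which
    here means \<open>0 \<in> D\<close>.\<close>
  moreover have "pow_nullspace D R 1 \<subseteq> pow_nullspace D R 2"
  proof
    fix x assume "x \<in> pow_nullspace D R 1"
    then have x: "x \<in> D" "R x = 0" by (auto simp: pow_nullspace_def pow_domain_def)
    have "0 \<in> D" using D_subspace by (rule complex_vector.subspace_0)
    have "V 0 = 0" using V_linear(1) by (simp add: bounded_linear.linear linear_0)
    then have "S 0 = 0" using S_V[of 0] by simp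
    then have "R 0 = 0" by (simp add: R_def shift_operator_def)
    then show "x \<in> pow_nullspace D R 2"
      using x \<open>0 \<in> D\<close> by (auto simp: pow_nullspace_def pow_domain_def numeral_2_eq_2 less_Suc_eq)
  qed
  ultimately have "enat 1 \<in> {enat n | n. pow_nullspace D R n = pow_nullspace D R (n + 1)}"
    by (simp add: one_enat_def numeral_2_eq_2)
  then have "ascent D R \<le> enat 1" unfolding ascent_def by (rule Inf_lower)
  then show ?thesis by (cases "ascent D R") auto
qed

text \<open>Stabilization of the ranges at any \<open>n\<close> descends to \<open>n = 1\<close>,
  since a power of \<open>W\<close> has no larger kernel than \<open>W\<close>.\<close>

private lemma drazin_iff: "\<nu> \<notin> drazin_spectrum D S \<longleftrightarrow> range W \<subseteq> range (W \<circ> W)"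
proof -
  have "\<nu> \<notin> drazin_spectrum D S \<longleftrightarrow> descent D R \<noteq> \<infinity>"
    using ascent_shift by (simp add: drazin_spectrum_def drazin_invertible_def R_def)
  also have "\<dots> \<longleftrightarrow> (\<exists>n. range (W ^^ n) = range (W ^^ Suc n))"
  proof
    assume "descent D R \<noteq> \<infinity>"
    then have "{enat n | n. pow_range D R n = pow_range D R (n + 1)} \<noteq> {}"
      unfolding descent_def by (metis Inf_empty top_enat_def)
    then show "\<exists>n. range (W ^^ n) = range (W ^^ Suc n)" by (auto simp: pow_range_shift)
  next
    assume "\<exists>n. range (W ^^ n) = range (W ^^ Suc n)"
    then obtain n where "enat n \<in> {enat n | n. pow_range D R n = pow_range D R (n + 1)}"
      by (auto simp: pow_range_shift)
    then have "descent D R \<le> enat n" unfolding descent_def by (rule Inf_lower)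
    then show "descent D R \<noteq> \<infinity>" by (cases "descent D R") auto
  qed
  also have "\<dots> \<longleftrightarrow> range W \<subseteq> range (W \<circ> W)"
  proof
    assume "\<exists>n. range (W ^^ n) = range (W ^^ Suc n)"
    then obtain n where n: "range (W ^^ n) = range (W ^^ Suc n)" by blast
    show "range W \<subseteq> range (W \<circ> W)"
    proof
      fix x assume "x \<in> range W"
      then obtain z where z: "x = W z" by blast
      obtain w where "(W ^^ n) z = (W ^^ Suc n) w" using n by blast
      \<comment> \<open>One extra \<open>W\<close> is applied so that the exponent is positive even
        for \<open>n = 0\<close>, as the kernel lemma needs.\<close>
      then have "(W ^^ Suc n) (z - W w) = 0"
        using linear_0[OF bounded_linear.linear[OF W_linear(1)]]
        by (simp add: funpow_W_diff funpow_swap1)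
      then have "W (z - W w) = 0" by (rule paranormal_funpow_kernel[OF W])
      then have "x = W (W w)" using z by (simp add: linear_diff[OF bounded_linear.linear[OF W_linear(1)]])
      then show "x \<in> range (W \<circ> W)" by auto
    qed
  next
    assume "range W \<subseteq> range (W \<circ> W)"
    then have "range (W ^^ 1) = range (W ^^ Suc 1)" by auto
    then show "\<exists>n. range (W ^^ n) = range (W ^^ Suc n)" by blast
  qed
  finally show ?thesis .
qed

lemmas resolvent_criteria = spectrum_iff drazin_iff

end

end

section \<open>Comparison of the spectra under quasisimilarity\<close>

lemma zero_notin_spectrum: "invertible_operator D S \<Longrightarrow> 0 \<notin> op_spectrum D S"
  by (simp add: op_spectrum_def shift_operator_def)

text \<open>One intertwiner yields one direction: the range conditions pass from \<open>T\<close> to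
  \<open>S\<close>, so spectral points pass from \<open>S\<close> to \<open>T\<close>. The
  restriction \<open>\<nu> \<noteq> 0\<close> permits the shift \<open>1 / \<nu>\<close> and
  suffices for the B-discrete spectrum, because 0 lies outside the spectrum.\<close>

lemma spectra_subset:
  fixes S T :: "'a::complex_banach \<Rightarrow> 'a"
  assumes "closed_operator D_S S" "closed_operator D_T T"
    and "invertible_operator D_S S" "invertible_operator D_T T"
    and "totally_paranormal (inv_into D_S S)" "totally_paranormal (inv_into D_T T)"
    and "quasi_invertible B" "B \<circ> inv_into D_T T = inv_into D_S S \<circ> B"
  shows "op_spectrum D_S S \<subseteq> op_spectrum D_T T"
    and "\<nu> \<noteq> 0 \<Longrightarrow> \<nu> \<in> drazin_spectrum D_S S \<Longrightarrow> \<nu> \<in> drazin_spectrum D_T T"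
proof -
  define V where "V = inv_into D_S S"
  define U where "U = inv_into D_T T"
  have B: "bounded_linear B" "closure (range B) = UNIV"
    using assms(7) by (auto simp: quasi_invertible_def bounded_clinear_def)
  interpret B: bounded_linear B by fact
  define VV where "VV \<mu> = (\<lambda>x. V x - \<mu> *\<^sub>C x)" for \<mu>
  define UU where "UU \<mu> = (\<lambda>x. U x - \<mu> *\<^sub>C x)" for \<mu>
  have BU: "B (U y) = V (B y)" for y
    using assms(8) unfolding V_def U_def by (metis comp_apply)
  have shift: "B (UU \<mu> y) = VV \<mu> (B y)" for \<mu> y
    using assms(7)
    by (simp add: UU_def VV_def B.diff BU quasi_invertible_def bounded_clinear_def)
  have p: "paranormal (VV \<mu>)" "paranormal (UU \<mu>)" for \<mu>
    using assms(5,6) by (auto simp: totally_paranormal_def VV_def UU_def V_def U_def)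
  note cS = resolvent_criteria[OF assms(1,3) V_def assms(5)[folded V_def] _ refl VV_def refl]
  note cT = resolvent_criteria[OF assms(2,4) U_def assms(6)[folded U_def] _ refl UU_def refl]
  show "op_spectrum D_S S \<subseteq> op_spectrum D_T T"
  proof
    fix \<nu> assume l: "\<nu> \<in> op_spectrum D_S S"
    then have "\<nu> \<noteq> 0" using zero_notin_spectrum[OF assms(3)] by metis
    show "\<nu> \<in> op_spectrum D_T T"
    proof (rule ccontr)
      assume "\<nu> \<notin> op_spectrum D_T T"
      then have "surj (UU (1 / \<nu>))" using cT(1)[OF \<open>\<nu> \<noteq> 0\<close>] by blast
      then have "surj (VV (1 / \<nu>))"
        by (rule paranormal_surj_transfer[of "VV (1 / \<nu>)" "UU (1 / \<nu>)" B, OF p(1) p(2) _ B shift])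
      then show False using l cS(1)[OF \<open>\<nu> \<noteq> 0\<close>] by blast
    qed
  qed
  show "\<nu> \<in> drazin_spectrum D_T T" if "\<nu> \<noteq> 0" and l: "\<nu> \<in> drazin_spectrum D_S S"
  proof (rule ccontr)
    assume "\<nu> \<notin> drazin_spectrum D_T T"
    then have "range (UU (1 / \<nu>)) \<subseteq> range (UU (1 / \<nu>) \<circ> UU (1 / \<nu>))"
      using cT(2)[OF \<open>\<nu> \<noteq> 0\<close>] by blast
    then have "range (VV (1 / \<nu>)) \<subseteq> range (VV (1 / \<nu>) \<circ> VV (1 / \<nu>))"
      by (rule paranormal_range_transfer(2)[of "VV (1 / \<nu>)" "UU (1 / \<nu>)" B, OF p(1) p(2) _ B shift])
    then show False using l cS(2)[OF \<open>\<nu> \<noteq> 0\<close>] by blast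
  qed
qed

theorem theorem4p3:
  fixes S T :: "'a::complex_banach \<Rightarrow> 'a" and D_S D_T :: "'a set"
  assumes "closed_operator D_S S" and "closed_operator D_T T"
    and "invertible_operator D_S S" and "invertible_operator D_T T"
    and "totally_paranormal (inv_into D_S S)" and "totally_paranormal (inv_into D_T T)"
    and "quasisimilar (inv_into D_S S) (inv_into D_T T)"
  shows "op_spectrum D_S S = op_spectrum D_T T
    \<and> b_discrete_spectrum D_S S = b_discrete_spectrum D_T T"
proof -
  obtain A B where AB: "quasi_invertible A" "A \<circ> inv_into D_S S = inv_into D_T T \<circ> A"
      "quasi_invertible B" "B \<circ> inv_into D_T T = inv_into D_S S \<circ> B"
    using assms(7) unfolding quasisimilar_def by blast
  \<comment> \<open>The two intertwiners give the two opposite inclusions.\<close>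
  note ST = spectra_subset[OF assms(1-6) AB(3,4)]
  note TS = spectra_subset[OF assms(2,1,4,3,6,5) AB(1,2)]
  have "op_spectrum D_S S = op_spectrum D_T T" using ST(1) TS(1) by (rule subset_antisym)
  moreover have "\<nu> \<in> drazin_spectrum D_S S \<longleftrightarrow> \<nu> \<in> drazin_spectrum D_T T"
    if "\<nu> \<in> op_spectrum D_S S" for \<nu>
  proof -
    have "\<nu> \<noteq> 0" using that zero_notin_spectrum[OF assms(3)] by metis
    then show ?thesis using ST(2) TS(2) by blast
  qed
  ultimately show ?thesis unfolding b_discrete_spectrum_def by blast
qed

end
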